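(* Let $K$ be an algebraically closed field and let $P(x)=\sum_{i=0}^n x^iP_i$ be a regular $m\times m$ matrix polynomial of degree $n$ over $K$. Let $b_1(x),\ldots,b_q(x)\in K[x]$ be pairwise co-prime monic polynomials of degrees $\deg b_i(x)=d_i\ge 1$ with $\sum_{i=1}^q d_i=n$, and let $s\in K$ be such that $\lambda b_q(\xi)+s\ne 0$ for any eigenvalue $\lambda$ of $P_n$ and any root $\xi$ of $b_i(x)$, for $i=1,\ldots,q-1$. Define $$B_i(x)=b_i(x)I_m\ \ (i=1,\ldots,q-1),\qquad B_q(x)=b_q(x)P_n+sI_m,$$ and $C_i(x)=\prod_{j\ne i}B_j(x)$. Then there exists a unique decomposition $$P(x)=B(x)+\sum_{i=1}^q W_i(x)C_i(x),\qquad B(x)=\prod_{i=1}^q B_i(x),$$ where $W_i(x)$ are $m\times m$ matrix polynomials of degree less than $d_i$ for $i=1,\ldots,q$, defined by $$W_i(x)=\frac{P(x)}{\prod_{j=1,\,j\ne i}^{q-1}b_j(x)}\,(b_q(x)P_n+sI_m)^{-1}\mod b_i(x),\quad i=1,\ldots,q-1,$$ $$W_q(x)=\frac{1}{\prod_{j=1}^{q-1}b_j(x)}P(x)-sI_m-s\sum_{j=1}^{q-1}\frac{W_j(x)}{b_j(x)}\mod b_q(x).$$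
   Context: A matrix polynomial is regular if its determinant is not identically zero, and $P$ has degree $n$ if $P_n\ne 0$. The zero polynomial is regarded as having degree smaller than any nonnegative integer. For a matrix polynomial $V(x)$, "$V(x) \bmod b(x)$" denotes the entrywise remainder of division by the scalar polynomial $b(x)$; inverses of scalar polynomials and of matrix polynomials inside an expression taken mod $b(x)$ are inverses in $K[x]/(b(x))$ and in the ring of $m\times m$ matrices over $K[x]/(b(x))$, respectively. *)

theory Defs
  imports "Jordan_Normal_Form.Char_Poly" "HOL-Library.FuncSet"
begin

text \<open>An \<open>m \<times> m\<close> matrix polynomial over \<open>K\<close> is an element of \<open>carrier_mat m m\<close> with entries in
  \<open>K[x]\<close>.\<close>

definition const_mat :: "'a::zero mat \<Rightarrow> 'a poly mat" where
  "const_mat A = map_mat (\<lambda>c. [:c:]) A"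

definition mat_coeff :: "'a::zero poly mat \<Rightarrow> nat \<Rightarrow> 'a mat" where
  "mat_coeff V k = map_mat (\<lambda>p. coeff p k) V"

text \<open>Phrased through coefficients, so that the zero matrix polynomial has degree less than
  every \<open>d\<close>, including \<open>d = 0\<close>.\<close>

definition mat_degree_less :: "'a::zero poly mat \<Rightarrow> nat \<Rightarrow> bool" where
  "mat_degree_less V d \<longleftrightarrow> (\<forall>k\<ge>d. mat_coeff V k = 0\<^sub>m (dim_row V) (dim_col V))"

text \<open>Matrices with explicit dimensions form no additive or multiplicative type-class monoid, so
  finite sums are taken entrywise, and products are taken along a list of indices, from left to
  right.\<close>

definition mat_sum :: "nat \<Rightarrow> ('i \<Rightarrow> 'a::comm_monoid_add mat) \<Rightarrow> 'i set \<Rightarrow> 'a mat" where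
  "mat_sum m F I = mat m m (\<lambda>(r, c). \<Sum>i\<in>I. F i $$ (r, c))"

definition mat_prod :: "nat \<Rightarrow> ('i \<Rightarrow> 'a::semiring_1 mat) \<Rightarrow> 'i list \<Rightarrow> 'a mat" where
  "mat_prod m F js = foldr (\<lambda>j A. F j * A) js (1\<^sub>m m)"

definition mat_mod :: "'a::field poly mat \<Rightarrow> 'a poly \<Rightarrow> 'a poly mat" where
  "mat_mod V b = map_mat (\<lambda>p. p mod b) V"

text \<open>Elements of \<open>K[x]/(b)\<close>, and of the matrix ring over it, are represented by their remainders
  modulo \<open>b\<close>. The description operators below are meaningful only if an inverse exists; it is
  then unique.\<close>

definition is_inverse_mod :: "'a::field poly \<Rightarrow> 'a poly \<Rightarrow> 'a poly \<Rightarrow> bool" where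
  "is_inverse_mod b p r \<longleftrightarrow> r mod b = r \<and> (p * r) mod b = 1 mod b"

definition inverse_mod :: "'a::field poly \<Rightarrow> 'a poly \<Rightarrow> 'a poly" where
  "inverse_mod b p = (THE r. is_inverse_mod b p r)"

definition is_mat_inverse_mod :: "'a::field poly \<Rightarrow> 'a poly mat \<Rightarrow> 'a poly mat \<Rightarrow> bool" where
  "is_mat_inverse_mod b A R \<longleftrightarrow>
     R \<in> carrier_mat (dim_row A) (dim_row A) \<and> mat_mod R b = R \<and>
     mat_mod (A * R) b = mat_mod (1\<^sub>m (dim_row A)) b \<and>
     mat_mod (R * A) b = mat_mod (1\<^sub>m (dim_row A)) b"

definition mat_inverse_mod :: "'a::field poly \<Rightarrow> 'a poly mat \<Rightarrow> 'a poly mat" where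
  "mat_inverse_mod b A = (THE R. is_mat_inverse_mod b A R)"

end

theory Submission
  imports Defs "HOL-Number_Theory.Cong"
begin

text \<open>Write \<open>\<beta>\<close> for the product of \<open>b\<^sub>1, \<dots>, b\<^bsub>q-1\<^esub>\<close>, \<open>\<beta>\<^sub>i\<close> for the same
  product without \<open>b\<^sub>i\<close>, and \<open>M = b\<^sub>q P\<^sub>n + s I\<close> for the last factor. All other factors
  are scalar matrices, so \<open>B = \<beta> M\<close>, \<open>C\<^sub>i = \<beta>\<^sub>i M\<close> for \<open>i < q\<close> and \<open>C\<^sub>q = \<beta> I\<close>, and the
  decomposition reads
  \<open>P = \<beta> M + (\<Sum>i<q. \<beta>\<^sub>i W\<^sub>i M) + \<beta> W\<^sub>q\<close>: a partial fraction decomposition over the scalar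
  moduli \<open>b\<^sub>1, \<dots>, b\<^bsub>q-1\<^esub>\<close>, twisted on the right by the single matrix \<open>M\<close>.

  Modulo \<open>b\<^sub>i\<close> with \<open>i < q\<close> only one term survives, \<open>P \<equiv> \<beta>\<^sub>i W\<^sub>i M\<close>
  (\<open>partial_fractions_mod\<close>). Here \<open>\<beta>\<^sub>i\<close> is invertible because the \<open>b\<^sub>j\<close> are coprime. The matrix \<open>M\<close> is
  invertible because the condition on \<open>s\<close> says exactly that \<open>det M\<close> does not vanish at the
  roots of \<open>b\<^sub>i\<close> (\<open>det_affine_nonzero\<close>); over an algebraically closed field this makes
  \<open>det M\<close> coprime to \<open>b\<^sub>i\<close>, and then the adjugate of \<open>M\<close>, divided by \<open>det M\<close>, is the inverse.
  So \<open>W\<^sub>i\<close> is determined modulo \<open>b\<^sub>i\<close>, and hence determined, by its degree.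
  Modulo \<open>b\<^sub>q\<close> the matrix \<open>M\<close> becomes \<open>s I\<close>, and solving for \<open>W\<^sub>q\<close> gives the last formula
  (\<open>last_numerator_mod\<close>). The formulas express each \<open>W\<^sub>i\<close> through \<open>P\<close> and then \<open>W\<^sub>q\<close> through
  the others, so they contain uniqueness.

  For existence, take \<open>W\<^sub>i\<close> with \<open>i < q\<close> from the formula. Then every \<open>b\<^sub>i\<close>, and so also
  \<open>\<beta>\<close>, divides \<open>P - \<beta> M - (\<Sum>i<q. \<beta>\<^sub>i W\<^sub>i M)\<close>; the quotient is \<open>W\<^sub>q\<close>
  (\<open>partial_fractions_exist\<close>). Its degree is less than \<open>d\<^sub>q\<close> because the dividend has degree
  less than \<open>n\<close>: since \<open>\<beta> b\<^sub>q\<close> is monic of degree \<open>n\<close>, the coefficient \<open>P\<^sub>n\<close> built into \<open>M\<close>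
  cancels the one of \<open>P\<close>.\<close>

section \<open>Inverses modulo a polynomial\<close>

text \<open>Stated with a common divisor instead of a gcd, so that it applies to polynomials over an
  arbitrary field, where no canonical gcd is fixed.\<close>

lemma bezout_euclid:
  fixes p q :: "'a::euclidean_ring"
  shows "\<exists>u v. u * p + v * q dvd p \<and> u * p + v * q dvd q"
proof (induction "euclidean_size q" arbitrary: p q rule: less_induct)
  case less
  show ?case
  proof (cases "q = 0")
    case True
    then show ?thesis by (intro exI[of _ 1] exI[of _ 0]) simp
  next
    case False
    from less[OF mod_size_less[OF False]] obtain u v
      where uv: "u * q + v * (p mod q) dvd q" "u * q + v * (p mod q) dvd p mod q" by blast
    have eq: "u * q + v * (p mod q) = v * p + (u - v * (p div q)) * q"
      by (simp add: minus_div_mult_eq_mod [symmetric] algebra_simps)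
    have "u * q + v * (p mod q) dvd p"
      using uv by (metis dvd_mod_imp_dvd)
    with uv eq show ?thesis by metis
  qed
qed

lemma ex_is_inverse_modI:
  assumes "[p * r = 1] (mod b)"
  shows "\<exists>r. is_inverse_mod b p r"
  using assms by (auto simp: is_inverse_mod_def cong_def mod_mult_right_eq intro!: exI[of _ "r mod b"])

lemma coprime_imp_inverse_mod:
  fixes p b :: "'a::field poly"
  assumes "coprime p b"
  shows "\<exists>r. is_inverse_mod b p r"
proof -
  obtain u v where "u * p + v * b dvd p" "u * p + v * b dvd b"
    using bezout_euclid by blast
  with assms have "u * p + v * b dvd 1" by (metis coprime_common_divisor)
  then obtain w where "1 = (u * p + v * b) * w" unfolding dvd_def by blast
  then have "p * (u * w) = 1 + b * (- v * w)" by (simp add: algebra_simps)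
  then have "[p * (u * w) = 1] (mod b)"
    by (simp add: cong_iff_dvd_diff)
  then show ?thesis by (rule ex_is_inverse_modI)
qed

lemma cong_inverse_mod:
  assumes "\<exists>r. is_inverse_mod b p r"
  shows "[p * inverse_mod b p = 1] (mod b)"
proof -
  from assms obtain r where r: "is_inverse_mod b p r" ..
  have "is_inverse_mod b p (inverse_mod b p)"
    unfolding inverse_mod_def
  proof (rule theI[of _ r])
    show "is_inverse_mod b p r" by fact
    fix t assume t: "is_inverse_mod b p t"
    then have "[p * t = 1] (mod b)" by (simp add: is_inverse_mod_def cong_def)
    then have "[r * (p * t) = r * 1] (mod b)" by (rule cong_mult[OF cong_refl])
    moreover have "[p * r = 1] (mod b)" using r by (simp add: is_inverse_mod_def cong_def)
    then have "[t * (p * r) = t * 1] (mod b)" by (rule cong_mult[OF cong_refl])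
    ultimately have "t mod b = r mod b" by (simp add: cong_def ac_simps)
    with r t show "t = r" by (simp add: is_inverse_mod_def)
  qed
  then show ?thesis by (simp add: is_inverse_mod_def cong_def)
qed

lemma prod_inverse_mod:
  assumes "\<And>j. j \<in> J \<Longrightarrow> \<exists>r. is_inverse_mod b (f j) r"
  shows "\<exists>r. is_inverse_mod b (\<Prod>j\<in>J. f j) r"
proof (rule ex_is_inverse_modI)
  have "[(\<Prod>j\<in>J. f j * inverse_mod b (f j)) = (\<Prod>j\<in>J. 1)] (mod b)"
    by (rule cong_prod) (use assms cong_inverse_mod in blast)
  then show "[(\<Prod>j\<in>J. f j) * (\<Prod>j\<in>J. inverse_mod b (f j)) = 1] (mod b)"
    by (simp add: prod.distrib)
qed

lemma inverse_mod_cancel: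
  assumes "\<exists>r. is_inverse_mod b p r"
  shows "[inverse_mod b p * (p * x) = x] (mod b)"
  using cong_mult[OF cong_inverse_mod[OF assms] cong_refl[of x]] by (simp add: ac_simps)

text \<open>By induction: if the product of the earlier factors divides \<open>x\<close> with quotient \<open>k\<close>, that
  product is invertible modulo the next factor \<open>f i\<close>, so \<open>f i\<close> must divide \<open>k\<close>.\<close>

lemma prod_dvd_if_pairwise_coprime:
  fixes f :: "'i \<Rightarrow> 'a::field poly"
  assumes "finite J"
    and "\<And>i j. i \<in> J \<Longrightarrow> j \<in> J \<Longrightarrow> i \<noteq> j \<Longrightarrow> coprime (f i) (f j)"
    and "\<And>j. j \<in> J \<Longrightarrow> f j dvd x"
  shows "(\<Prod>j\<in>J. f j) dvd x"
  using assms
proof (induction J rule: finite_induct)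
  case (insert i J)
  then obtain k where k: "x = prod f J * k" by (auto elim!: dvdE)
  have inv: "\<exists>r. is_inverse_mod (f i) (prod f J) r"
    by (rule prod_inverse_mod, rule coprime_imp_inverse_mod) (use insert in auto)
  have "[prod f J * k = 0] (mod f i)"
    using insert.prems(2)[of i] k by (simp add: cong_0_iff)
  then have "[inverse_mod (f i) (prod f J) * (prod f J * k) = inverse_mod (f i) (prod f J) * 0] (mod f i)"
    by (rule cong_mult[OF cong_refl])
  with inverse_mod_cancel[OF inv, of k] have "[k = 0] (mod f i)"
    by (metis cong_sym cong_trans mult_zero_right)
  then show ?case
    using insert.hyps k by (simp add: cong_0_iff mult.commute mult_dvd_mono)
qed simp

section \<open>Congruences of matrix polynomials\<close>

lemma mat_mod_carrier [simp]: "mat_mod V b \<in> carrier_mat nr nc \<longleftrightarrow> V \<in> carrier_mat nr nc"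
  by (simp add: mat_mod_def)

lemma dim_mat_mod [simp]: "dim_row (mat_mod V b) = dim_row V" "dim_col (mat_mod V b) = dim_col V"
  by (simp_all add: mat_mod_def)

lemma index_mat_mod [simp]:
  "i < dim_row V \<Longrightarrow> j < dim_col V \<Longrightarrow> mat_mod V b $$ (i, j) = V $$ (i, j) mod b"
  by (simp add: mat_mod_def)

lemma mat_sum_carrier [simp]: "mat_sum m F I \<in> carrier_mat m m"
  by (simp add: mat_sum_def)

lemma dim_mat_sum [simp]: "dim_row (mat_sum m F I) = m" "dim_col (mat_sum m F I) = m"
  by (simp_all add: mat_sum_def)

lemma index_mat_sum [simp]:
  "r < m \<Longrightarrow> c < m \<Longrightarrow> mat_sum m F I $$ (r, c) = (\<Sum>i\<in>I. F i $$ (r, c))"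
  by (simp add: mat_sum_def)

lemma mat_sum_cong:
  "(\<And>i. i \<in> I \<Longrightarrow> F i = G i) \<Longrightarrow> mat_sum m F I = mat_sum m G I"
  by (simp add: mat_sum_def)

lemma mat_mod_eq_iff:
  assumes "A \<in> carrier_mat nr nc" "A' \<in> carrier_mat nr nc"
  shows "mat_mod A b = mat_mod A' b \<longleftrightarrow>
    (\<forall>r<nr. \<forall>c<nc. [A $$ (r, c) = A' $$ (r, c)] (mod b))"
  using assms by (auto simp: mat_eq_iff cong_def)

lemma mat_mod_mat_mod [simp]: "mat_mod (mat_mod A b) b = mat_mod A b"
  by (rule eq_matI) auto

lemma mat_mod_mult_cong:
  assumes "mat_mod A b = mat_mod A' b" "mat_mod D b = mat_mod D' b"
    and "A \<in> carrier_mat nr m" "A' \<in> carrier_mat nr m" "D \<in> carrier_mat m nc" "D' \<in> carrier_mat m nc"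
  shows "mat_mod (A * D) b = mat_mod (A' * D') b"
proof -
  have "[(A * D) $$ (r, c) = (A' * D') $$ (r, c)] (mod b)" if "r < nr" "c < nc" for r c
    using assms that by (auto simp: scalar_prod_def mat_mod_eq_iff intro!: cong_sum cong_mult)
  then show ?thesis
    using assms by (subst mat_mod_eq_iff[of _ nr nc]) auto
qed

lemma mat_mod_smult_cong:
  assumes "[x = y] (mod b)" "mat_mod A b = mat_mod A' b"
    and "A \<in> carrier_mat nr nc" "A' \<in> carrier_mat nr nc"
  shows "mat_mod (x \<cdot>\<^sub>m A) b = mat_mod (y \<cdot>\<^sub>m A') b"
  using assms by (subst mat_mod_eq_iff[of _ nr nc]) (auto simp: mat_mod_eq_iff intro!: cong_mult)

section \<open>Invertibility of a matrix polynomial modulo a polynomial\<close>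

text \<open>Cramer's rule: the adjugate times an inverse of the determinant.\<close>

lemma det_coprime_imp_mat_inverse_mod:
  assumes A: "A \<in> carrier_mat m m" and "coprime (det A) b"
  shows "\<exists>R. is_mat_inverse_mod b A R"
proof -
  define t where "t = inverse_mod b (det A)"
  define R where "R = mat_mod (t \<cdot>\<^sub>m adj_mat A) b"
  have t: "[t * det A = 1] (mod b)"
    unfolding t_def using cong_inverse_mod[OF coprime_imp_inverse_mod[OF assms(2)]]
    by (simp add: mult.commute)
  note adj = adj_mat[OF A]
  have one: "mat_mod (t \<cdot>\<^sub>m (det A \<cdot>\<^sub>m 1\<^sub>m m)) b = mat_mod (1\<^sub>m m) b"
    using t by (subst mat_mod_eq_iff[of _ m m]) auto
  have "mat_mod (A * R) b = mat_mod (A * (t \<cdot>\<^sub>m adj_mat A)) b"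
    by (rule mat_mod_mult_cong) (use A adj in \<open>auto simp: R_def\<close>)
  also have "A * (t \<cdot>\<^sub>m adj_mat A) = t \<cdot>\<^sub>m (det A \<cdot>\<^sub>m 1\<^sub>m m)"
    using A adj by (simp add: mult_smult_distrib)
  finally have 1: "mat_mod (A * R) b = mat_mod (1\<^sub>m m) b" by (simp add: one)
  have "mat_mod (R * A) b = mat_mod ((t \<cdot>\<^sub>m adj_mat A) * A) b"
    by (rule mat_mod_mult_cong) (use A adj in \<open>auto simp: R_def\<close>)
  also have "(t \<cdot>\<^sub>m adj_mat A) * A = t \<cdot>\<^sub>m (det A \<cdot>\<^sub>m 1\<^sub>m m)"
    using A adj by (simp add: mult_smult_assoc_mat)
  finally have "mat_mod (R * A) b = mat_mod (1\<^sub>m m) b" by (simp add: one)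
  with 1 A adj show ?thesis
    by (auto simp: is_mat_inverse_mod_def R_def intro!: exI[of _ R])
qed

text \<open>Both inverses equal \<open>R A T\<close> modulo \<open>b\<close>, and both are reduced.\<close>

lemma mat_inverse_mod_unique:
  assumes A: "A \<in> carrier_mat m m"
    and R: "is_mat_inverse_mod b A R" and T: "is_mat_inverse_mod b A T"
  shows "R = T"
proof -
  have c: "R \<in> carrier_mat m m" "T \<in> carrier_mat m m"
    using A R T by (auto simp: is_mat_inverse_mod_def)
  have "mat_mod (R * (A * T)) b = mat_mod (R * 1\<^sub>m m) b"
    by (rule mat_mod_mult_cong) (use A T c in \<open>auto simp: is_mat_inverse_mod_def\<close>)
  moreover have "mat_mod ((R * A) * T) b = mat_mod (1\<^sub>m m * T) b"
    by (rule mat_mod_mult_cong) (use A R c in \<open>auto simp: is_mat_inverse_mod_def\<close>)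
  ultimately have "mat_mod R b = mat_mod T b"
    using A c by (simp add: assoc_mult_mat[of _ m m _ m _ m])
  with R T show ?thesis by (simp add: is_mat_inverse_mod_def)
qed

lemma mat_inverse_mod_works:
  assumes A: "A \<in> carrier_mat m m" and "\<exists>R. is_mat_inverse_mod b A R"
  shows "mat_inverse_mod b A \<in> carrier_mat m m"
    and "mat_mod (A * mat_inverse_mod b A) b = mat_mod (1\<^sub>m m) b"
    and "mat_mod (mat_inverse_mod b A * A) b = mat_mod (1\<^sub>m m) b"
proof -
  have "is_mat_inverse_mod b A (mat_inverse_mod b A)"
    unfolding mat_inverse_mod_def
    using assms(2) mat_inverse_mod_unique[OF A] by (metis theI)
  with A show "mat_inverse_mod b A \<in> carrier_mat m m"
    "mat_mod (A * mat_inverse_mod b A) b = mat_mod (1\<^sub>m m) b"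
    "mat_mod (mat_inverse_mod b A * A) b = mat_mod (1\<^sub>m m) b"
    by (auto simp: is_mat_inverse_mod_def)
qed

text \<open>A common divisor that is not a unit would have a root, as the field is algebraically
  closed.\<close>

lemma coprime_if_no_common_root:
  fixes p b :: "'a::alg_closed_field poly"
  assumes "b \<noteq> 0" and "\<And>x. poly b x = 0 \<Longrightarrow> poly p x \<noteq> 0"
  shows "coprime p b"
proof (rule coprimeI)
  fix c assume c: "c dvd p" "c dvd b"
  show "is_unit c"
  proof (rule ccontr)
    assume "\<not> is_unit c"
    moreover have "c \<noteq> 0" using c assms(1) by auto
    ultimately have "degree c > 0" by (simp add: is_unit_iff_degree)
    then obtain x where "poly c x = 0" using alg_closed_imp_poly_has_root by blast
    with c assms(2) show False by (meson poly_eq_0_iff_dvd dvd_trans)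
  qed
qed

text \<open>Evaluation at \<open>x\<close> is a ring homomorphism, hence commutes with the determinant.\<close>

lemma poly_det_affine:
  fixes A :: "'a::comm_ring_1 mat"
  assumes "A \<in> carrier_mat m m"
  shows "poly (det (p \<cdot>\<^sub>m const_mat A + [:s:] \<cdot>\<^sub>m 1\<^sub>m m)) x = det (poly p x \<cdot>\<^sub>m A + s \<cdot>\<^sub>m 1\<^sub>m m)"
proof -
  have hom: "comm_ring_hom (\<lambda>p. poly p x)" by standard auto
  show ?thesis
    unfolding comm_ring_hom.hom_det[OF hom, symmetric]
    by (rule arg_cong[of _ _ det], rule eq_matI) (use assms in \<open>auto simp: const_mat_def\<close>)
qed

text \<open>For \<open>c \<noteq> 0\<close> the matrix is \<open>c\<close> times \<open>A + (s / c) I\<close>, which is singular only if \<open>- s / c\<close>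
  is an eigenvalue of \<open>A\<close>; and that eigenvalue is the one that the hypothesis forbids.\<close>

lemma det_affine_nonzero:
  fixes A :: "'a::field mat"
  assumes A: "A \<in> carrier_mat m m" and "c \<noteq> 0"
    and s: "\<And>l. eigenvalue A l \<Longrightarrow> l * c + s \<noteq> 0"
  shows "det (c \<cdot>\<^sub>m A + s \<cdot>\<^sub>m 1\<^sub>m m) \<noteq> 0"
proof
  assume "det (c \<cdot>\<^sub>m A + s \<cdot>\<^sub>m 1\<^sub>m m) = 0"
  moreover have "c \<cdot>\<^sub>m A + s \<cdot>\<^sub>m 1\<^sub>m m = c \<cdot>\<^sub>m char_matrix A (- s / c)"
    by (rule eq_matI) (use A \<open>c \<noteq> 0\<close> in \<open>auto simp: char_matrix_def algebra_simps\<close>)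
  ultimately have "det (char_matrix A (- s / c)) = 0"
    using \<open>c \<noteq> 0\<close> by simp
  then have "eigenvalue A (- s / c)" using A by (simp add: eigenvalue_det)
  from s[OF this] \<open>c \<noteq> 0\<close> show False by simp
qed

section \<open>Degrees of matrix polynomials\<close>

lemma mat_degree_less_iff:
  assumes "V \<in> carrier_mat nr nc"
  shows "mat_degree_less V d \<longleftrightarrow> (\<forall>r<nr. \<forall>c<nc. \<forall>k\<ge>d. coeff (V $$ (r, c)) k = 0)"
  using assms by (auto simp: mat_degree_less_def mat_coeff_def mat_eq_iff)

lemma coeffs_vanish_iff_mod:
  fixes p b :: "'a::field poly"
  assumes "degree b > 0"
  shows "(\<forall>k\<ge>degree b. coeff p k = 0) \<longleftrightarrow> p mod b = p"
proof
  assume "\<forall>k\<ge>degree b. coeff p k = 0"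
  then have "degree p < degree b"
    using assms by (metis leading_coeff_0_iff degree_0 not_le)
  then show "p mod b = p" by (rule mod_poly_less)
next
  assume eq: "p mod b = p"
  have "b \<noteq> 0" using assms by auto
  then have "p = 0 \<or> degree p < degree b" using degree_mod_less[of b p] eq by simp
  then show "\<forall>k\<ge>degree b. coeff p k = 0" by (auto intro: coeff_eq_0)
qed

text \<open>Turns the degree bounds on the numerators into the statement that they are reduced, so that a
  congruence modulo \<open>b\<close> determines them.\<close>

lemma mat_degree_less_iff_mod:
  assumes V: "V \<in> carrier_mat nr nc" and "degree b > 0"
  shows "mat_degree_less V (degree b) \<longleftrightarrow> mat_mod V b = V"
  using V by (simp add: mat_degree_less_iff[OF V] coeffs_vanish_iff_mod[OF assms(2)] mat_eq_iff)

lemma coeffs_vanish_mult: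
  fixes p q :: "'a::comm_semiring_0 poly"
  assumes "\<forall>k\<ge>d. coeff p k = 0" "\<forall>k>e. coeff q k = 0" "k \<ge> d + e"
  shows "coeff (p * q) k = 0"
  unfolding coeff_mult
proof (rule sum.neutral, intro ballI)
  fix i assume "i \<in> {..k}"
  then have "i \<ge> d \<or> k - i > e" using assms(3) by auto
  then show "coeff p i * coeff q (k - i) = 0" using assms by auto
qed

text \<open>The bound on \<open>D\<close> is the non-strict \<open>deg D \<le> e\<close>: only one of the two bounds can be strict
  if the sum \<open>d + e\<close> is to be sharp.\<close>

lemma mat_degree_less_mult:
  assumes "mat_degree_less A d" "mat_degree_less D (Suc e)"
    and "A \<in> carrier_mat nr m" "D \<in> carrier_mat m nc"
  shows "mat_degree_less (A * D) (d + e)"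
  using assms
  by (subst mat_degree_less_iff[of _ nr nc])
     (auto simp: mat_degree_less_iff scalar_prod_def coeff_sum Suc_le_eq
       intro!: sum.neutral coeffs_vanish_mult)

lemma mat_degree_less_smult:
  assumes "mat_degree_less A d" "A \<in> carrier_mat nr nc"
  shows "mat_degree_less (p \<cdot>\<^sub>m A) (d + degree p)"
  using assms
  by (subst mat_degree_less_iff[of _ nr nc])
     (auto simp: mat_degree_less_iff mult.commute[of p] coeff_eq_0
       intro!: coeffs_vanish_mult)

lemma mat_degree_less_minus:
  fixes A D :: "'a::ab_group_add poly mat"
  assumes "mat_degree_less A d" "mat_degree_less D d"
    and "A \<in> carrier_mat nr nc" "D \<in> carrier_mat nr nc"
  shows "mat_degree_less (A - D) d"
  using assms
  by (subst mat_degree_less_iff[of _ nr nc]) (auto simp: mat_degree_less_iff)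

lemma mat_degree_less_sum:
  assumes "\<And>i. i \<in> I \<Longrightarrow> mat_degree_less (F i) d" "\<And>i. i \<in> I \<Longrightarrow> F i \<in> carrier_mat m m"
  shows "mat_degree_less (mat_sum m F I) d"
proof -
  have "coeff (F i $$ (r, c)) k = 0" if "i \<in> I" "r < m" "c < m" "k \<ge> d" for i r c k
    using assms(1)[OF that(1)] that mat_degree_less_iff[OF assms(2)[OF that(1)]] by blast
  then show ?thesis
    by (subst mat_degree_less_iff[of _ m m]) (auto simp: coeff_sum intro!: sum.neutral)
qed

lemma mat_degree_less_smult_cancel:
  fixes p :: "'a::idom poly"
  assumes "mat_degree_less (p \<cdot>\<^sub>m A) (d + degree p)" "p \<noteq> 0" and A: "A \<in> carrier_mat nr nc"
  shows "mat_degree_less A d"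
  unfolding mat_degree_less_iff[OF A]
proof (intro allI impI)
  fix r c k assume rc: "r < nr" "c < nc" and k: "d \<le> k"
  have pA: "p \<cdot>\<^sub>m A \<in> carrier_mat nr nc" using A by simp
  show "coeff (A $$ (r, c)) k = 0"
  proof (rule ccontr)
    assume k0: "coeff (A $$ (r, c)) k \<noteq> 0"
    then have "degree (A $$ (r, c)) \<ge> k" "A $$ (r, c) \<noteq> 0" by (auto intro: le_degree)
    then have "coeff (p * A $$ (r, c)) (degree (p * A $$ (r, c))) = 0"
      using assms(1) rc k A assms(2) unfolding mat_degree_less_iff[OF pA]
      by (auto simp: degree_mult_eq simp del: leading_coeff_0_iff coeff_degree_mult)
    then show False using \<open>A $$ (r, c) \<noteq> 0\<close> assms(2) by simp
  qed
qed

section \<open>Products with scalar matrix factors\<close>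

lemma foldr_scalar_mat_mult:
  fixes f :: "'i \<Rightarrow> 'a::comm_ring_1"
  assumes "\<And>j. j \<in> set js \<Longrightarrow> F j = f j \<cdot>\<^sub>m 1\<^sub>m m" and M: "M \<in> carrier_mat m m"
  shows "foldr (\<lambda>j A. F j * A) js M = prod_list (map f js) \<cdot>\<^sub>m M"
  using assms(1)
proof (induction js)
  case Nil
  then show ?case using M by (auto intro!: eq_matI)
next
  case (Cons j js)
  have "f j \<cdot>\<^sub>m 1\<^sub>m m * (prod_list (map f js) \<cdot>\<^sub>m M) = f j \<cdot>\<^sub>m (prod_list (map f js) \<cdot>\<^sub>m M)"
    using M by (simp add: mult_smult_assoc_mat[of _ m m _ m])
  also have "\<dots> = (f j * prod_list (map f js)) \<cdot>\<^sub>m M"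
    by (rule eq_matI) (use M in \<open>auto simp: mult.assoc\<close>)
  finally show ?case using Cons by simp
qed

lemma mat_prod_scalars:
  fixes f :: "'i \<Rightarrow> 'a::comm_ring_1"
  assumes "distinct js" "\<And>j. j \<in> set js \<Longrightarrow> F j = f j \<cdot>\<^sub>m 1\<^sub>m m"
  shows "mat_prod m F js = (\<Prod>j\<in>set js. f j) \<cdot>\<^sub>m 1\<^sub>m m"
    and "F k \<in> carrier_mat m m \<Longrightarrow> mat_prod m F (js @ [k]) = (\<Prod>j\<in>set js. f j) \<cdot>\<^sub>m F k"
  using assms foldr_scalar_mat_mult[of js F f m]
  by (simp_all add: mat_prod_def prod.distinct_set_conv_list)

section \<open>Partial fractions\<close>

text \<open>The \<open>i\<close>-th summand is the only one whose scalar coefficient lacks the factor \<open>f i\<close>.\<close>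

lemma partial_fractions_mod:
  fixes f :: "'i \<Rightarrow> 'a::field poly"
  assumes J: "finite J" and i: "i \<in> J" and Y: "\<And>j. j \<in> J \<Longrightarrow> Y j \<in> carrier_mat m m"
    and Z: "Z \<in> carrier_mat m m"
  shows "mat_mod (mat_sum m (\<lambda>j. (\<Prod>k\<in>J - {j}. f k) \<cdot>\<^sub>m Y j) J + (\<Prod>k\<in>J. f k) \<cdot>\<^sub>m Z) (f i)
    = mat_mod ((\<Prod>k\<in>J - {i}. f k) \<cdot>\<^sub>m Y i) (f i)"
proof -
  have "[(\<Sum>j\<in>J. ((\<Prod>k\<in>J - {j}. f k) \<cdot>\<^sub>m Y j) $$ (r, c)) + (\<Prod>k\<in>J. f k) * Z $$ (r, c)
      = (\<Prod>k\<in>J - {i}. f k) * Y i $$ (r, c)] (mod f i)" if "r < m" "c < m" for r c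
  proof -
    have "f i dvd (\<Prod>k\<in>J. f k)" using J i by (rule dvd_prodI)
    moreover have "f i dvd (\<Sum>j\<in>J - {i}. ((\<Prod>k\<in>J - {j}. f k) \<cdot>\<^sub>m Y j) $$ (r, c))"
    proof (rule dvd_sum)
      fix j assume j: "j \<in> J - {i}"
      then have "f i dvd (\<Prod>k\<in>J - {j}. f k)" using J i by (intro dvd_prodI) auto
      then show "f i dvd ((\<Prod>k\<in>J - {j}. f k) \<cdot>\<^sub>m Y j) $$ (r, c)"
        using j Y[of j] that by simp
    qed
    moreover have "((\<Prod>k\<in>J - {i}. f k) \<cdot>\<^sub>m Y i) $$ (r, c) = (\<Prod>k\<in>J - {i}. f k) * Y i $$ (r, c)"
      using Y[OF i] that by simp
    ultimately show ?thesis
      using J i by (simp add: cong_iff_dvd_diff sum.remove[of J i])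
  qed
  then show ?thesis
    using Y[OF i] Z by (subst mat_mod_eq_iff[of _ m m]) auto
qed

text \<open>The difference between \<open>X\<close> and the sum is divisible by every \<open>f i\<close>, hence entrywise by
  their product; \<open>Z\<close> is the quotient. No degree is bounded here: \<open>Z\<close> absorbs the polynomial
  part as well.\<close>

lemma partial_fractions_exist:
  fixes f :: "'i \<Rightarrow> 'a::field poly"
  assumes J: "finite J"
    and cop: "\<And>i j. i \<in> J \<Longrightarrow> j \<in> J \<Longrightarrow> i \<noteq> j \<Longrightarrow> coprime (f i) (f j)"
    and X: "X \<in> carrier_mat m m" and Y: "\<And>j. j \<in> J \<Longrightarrow> Y j \<in> carrier_mat m m"
    and eq: "\<And>i. i \<in> J \<Longrightarrow> mat_mod X (f i) = mat_mod ((\<Prod>k\<in>J - {i}. f k) \<cdot>\<^sub>m Y i) (f i)"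
  shows "\<exists>Z. Z \<in> carrier_mat m m \<and>
    X = mat_sum m (\<lambda>j. (\<Prod>k\<in>J - {j}. f k) \<cdot>\<^sub>m Y j) J + (\<Prod>k\<in>J. f k) \<cdot>\<^sub>m Z"
proof -
  define S where "S = mat_sum m (\<lambda>j. (\<Prod>k\<in>J - {j}. f k) \<cdot>\<^sub>m Y j) J"
  have S: "S \<in> carrier_mat m m" by (simp add: S_def)
  have dvd: "(\<Prod>k\<in>J. f k) dvd X $$ (r, c) - S $$ (r, c)" if rc: "r < m" "c < m" for r c
  proof (rule prod_dvd_if_pairwise_coprime[OF J cop])
    fix i assume i: "i \<in> J"
    \<comment> \<open>The sum alone is the case of a zero last numerator.\<close>
    have "mat_mod (S + (\<Prod>k\<in>J. f k) \<cdot>\<^sub>m 0\<^sub>m m m) (f i) = mat_mod X (f i)"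
      unfolding S_def eq[OF i] by (rule partial_fractions_mod[OF J i Y]) auto
    then have "mat_mod X (f i) = mat_mod S (f i)" using S by simp
    then show "f i dvd X $$ (r, c) - S $$ (r, c)"
      using X S rc by (simp add: mat_mod_eq_iff cong_iff_dvd_diff)
  qed
  define Z where "Z = mat m m (\<lambda>(r, c). (X $$ (r, c) - S $$ (r, c)) div (\<Prod>k\<in>J. f k))"
  have "X = S + (\<Prod>k\<in>J. f k) \<cdot>\<^sub>m Z"
    by (rule eq_matI) (use X S dvd in \<open>auto simp: Z_def\<close>)
  then show ?thesis unfolding S_def by (intro exI[of _ Z]) (simp add: Z_def)
qed

text \<open>Multiplying the decomposition by an inverse of the product of all \<open>f j\<close> turns the coefficient
  of \<open>W j * M\<close> into an inverse of the single \<open>f j\<close>, and \<open>M\<close> acts as the scalar \<open>\<sigma>\<close> modulo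
  \<open>g\<close>.\<close>

lemma last_numerator_mod:
  fixes f :: "'i \<Rightarrow> 'a::field poly"
  assumes J: "finite J" and inv: "\<And>j. j \<in> J \<Longrightarrow> \<exists>r. is_inverse_mod g (f j) r"
    and M: "M \<in> carrier_mat m m" and M_mod: "mat_mod M g = mat_mod (\<sigma> \<cdot>\<^sub>m 1\<^sub>m m) g"
    and W: "\<And>j. j \<in> J \<Longrightarrow> W j \<in> carrier_mat m m" and Z: "Z \<in> carrier_mat m m"
    and P: "P = (\<Prod>j\<in>J. f j) \<cdot>\<^sub>m M +
      (mat_sum m (\<lambda>j. (\<Prod>k\<in>J - {j}. f k) \<cdot>\<^sub>m (W j * M)) J + (\<Prod>j\<in>J. f j) \<cdot>\<^sub>m Z)"
  shows "mat_mod Z g = mat_mod (inverse_mod g (\<Prod>j\<in>J. f j) \<cdot>\<^sub>m P - \<sigma> \<cdot>\<^sub>m 1\<^sub>m m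
    - \<sigma> \<cdot>\<^sub>m mat_sum m (\<lambda>j. inverse_mod g (f j) \<cdot>\<^sub>m W j) J) g"
proof -
  define \<beta> where "\<beta> = (\<Prod>j\<in>J. f j)"
  define t where "t = inverse_mod g \<beta>"
  have t: "[t * (\<beta> * x) = x] (mod g)" for x
    unfolding t_def \<beta>_def by (rule inverse_mod_cancel, rule prod_inverse_mod, rule inv)
  \<comment> \<open>Cancelling all factors but \<open>f j\<close> from the full product leaves an inverse of \<open>f j\<close>.\<close>
  have tj: "[t * ((\<Prod>k\<in>J - {j}. f k) * x) = inverse_mod g (f j) * x] (mod g)" if "j \<in> J" for j x
  proof -
    have \<beta>: "\<beta> = f j * (\<Prod>k\<in>J - {j}. f k)"
      unfolding \<beta>_def using J that by (rule prod.remove)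
    have "[inverse_mod g (f j) * (f j * (t * ((\<Prod>k\<in>J - {j}. f k) * x)))
        = t * ((\<Prod>k\<in>J - {j}. f k) * x)] (mod g)"
      by (rule inverse_mod_cancel[OF inv[OF that]])
    moreover have "inverse_mod g (f j) * (f j * (t * ((\<Prod>k\<in>J - {j}. f k) * x)))
        = inverse_mod g (f j) * (t * (\<beta> * x))"
      by (simp add: \<beta> ac_simps)
    moreover have "[inverse_mod g (f j) * (t * (\<beta> * x)) = inverse_mod g (f j) * x] (mod g)"
      by (intro cong_mult cong_refl t)
    ultimately show ?thesis by (metis cong_sym cong_trans)
  qed
  have WM: "[(W j * M) $$ (r, c) = \<sigma> * W j $$ (r, c)] (mod g)" if "j \<in> J" "r < m" "c < m" for j r c
  proof -
    have "mat_mod (W j * M) g = mat_mod (W j * (\<sigma> \<cdot>\<^sub>m 1\<^sub>m m)) g"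
      by (rule mat_mod_mult_cong[OF _ M_mod W[OF that(1)] W[OF that(1)] M]) auto
    also have "W j * (\<sigma> \<cdot>\<^sub>m 1\<^sub>m m) = \<sigma> \<cdot>\<^sub>m W j"
      using W[OF that(1)] by (simp add: mult_smult_distrib[of _ m m _ m])
    finally show ?thesis
      using that W[OF that(1)] M by (simp add: mat_mod_eq_iff[of _ m m])
  qed
  have "[t * P $$ (r, c) = \<sigma> * 1\<^sub>m m $$ (r, c)
      + ((\<Sum>j\<in>J. \<sigma> * (inverse_mod g (f j) * W j $$ (r, c))) + Z $$ (r, c))] (mod g)"
    if rc: "r < m" "c < m" for r c
  proof -
    have idx: "((\<Prod>k\<in>J - {j}. f k) \<cdot>\<^sub>m (W j * M)) $$ (r, c)
        = (\<Prod>k\<in>J - {j}. f k) * (W j * M) $$ (r, c)" if "j \<in> J" for j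
      using W[OF that] M rc by simp
    have "t * P $$ (r, c) = t * (\<beta> * M $$ (r, c))
        + ((\<Sum>j\<in>J. t * ((\<Prod>k\<in>J - {j}. f k) * (W j * M) $$ (r, c))) + t * (\<beta> * Z $$ (r, c)))"
      using M Z rc unfolding P \<beta>_def[symmetric]
      by (simp add: idx distrib_left sum_distrib_left)
    also have "[\<dots> = \<sigma> * 1\<^sub>m m $$ (r, c)
      + ((\<Sum>j\<in>J. \<sigma> * (inverse_mod g (f j) * W j $$ (r, c))) + Z $$ (r, c))] (mod g)"
    proof (intro cong_add cong_sum)
      have "[M $$ (r, c) = \<sigma> * 1\<^sub>m m $$ (r, c)] (mod g)"
        using M_mod M rc by (simp add: mat_mod_eq_iff[of _ m m])
      then show "[t * (\<beta> * M $$ (r, c)) = \<sigma> * 1\<^sub>m m $$ (r, c)] (mod g)"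
        using t cong_trans by blast
    next
      fix j assume j: "j \<in> J"
      note tj[OF j, of "(W j * M) $$ (r, c)"]
      also have "[inverse_mod g (f j) * (W j * M) $$ (r, c)
          = inverse_mod g (f j) * (\<sigma> * W j $$ (r, c))] (mod g)"
        by (rule cong_mult[OF cong_refl WM[OF j rc]])
      also have "inverse_mod g (f j) * (\<sigma> * W j $$ (r, c)) = \<sigma> * (inverse_mod g (f j) * W j $$ (r, c))"
        by (rule mult.left_commute)
      finally show "[t * ((\<Prod>k\<in>J - {j}. f k) * (W j * M) $$ (r, c))
          = \<sigma> * (inverse_mod g (f j) * W j $$ (r, c))] (mod g)" .
    qed (rule t)
    finally show ?thesis .
  qed
  moreover have "(inverse_mod g (f j) \<cdot>\<^sub>m W j) $$ (r, c) = inverse_mod g (f j) * W j $$ (r, c)"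
    if "j \<in> J" "r < m" "c < m" for j r c
    using W[OF that(1)] that by simp
  moreover have "P \<in> carrier_mat m m" unfolding P using M Z by simp
  ultimately show ?thesis
    using Z unfolding \<beta>_def[symmetric] t_def[symmetric]
    by (subst mat_mod_eq_iff[of _ m m])
       (auto simp: cong_iff_dvd_diff sum_distrib_left dvd_diff_commute algebra_simps)
qed

theorem theorem4p2:
  fixes m n q :: nat
    and Pc :: "nat \<Rightarrow> 'a::alg_closed_field mat"
    and P :: "'a poly mat"
    and b :: "nat \<Rightarrow> 'a poly"
    and d :: "nat \<Rightarrow> nat"
    and s :: 'a
    and B C :: "nat \<Rightarrow> 'a poly mat"
    and is_decomposition :: "(nat \<Rightarrow> 'a poly mat) \<Rightarrow> bool"
  assumes Pc_carrier: "\<And>i. i \<le> n \<Longrightarrow> Pc i \<in> carrier_mat m m"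
    and P_eq: "P = mat_sum m (\<lambda>i. monom 1 i \<cdot>\<^sub>m const_mat (Pc i)) {0..n}"
    and P_degree: "Pc n \<noteq> 0\<^sub>m m m"
    and P_regular: "det P \<noteq> 0"
    and q: "q \<ge> 1"
    and b_monic: "\<And>i. i \<in> {1..q} \<Longrightarrow> lead_coeff (b i) = 1"
    and b_degree: "\<And>i. i \<in> {1..q} \<Longrightarrow> degree (b i) = d i"
    and d_pos: "\<And>i. i \<in> {1..q} \<Longrightarrow> d i \<ge> 1"
    and d_sum: "(\<Sum>i=1..q. d i) = n"
    and b_coprime: "\<And>i j. i \<in> {1..q} \<Longrightarrow> j \<in> {1..q} \<Longrightarrow> i \<noteq> j \<Longrightarrow> coprime (b i) (b j)"
    and s: "\<And>i l x. i \<in> {1..<q} \<Longrightarrow> eigenvalue (Pc n) l \<Longrightarrow> poly (b i) x = 0 \<Longrightarrow>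
              l * poly (b q) x + s \<noteq> 0"
  defines "B \<equiv> \<lambda>i. if i < q then b i \<cdot>\<^sub>m 1\<^sub>m m
                   else b q \<cdot>\<^sub>m const_mat (Pc n) + [:s:] \<cdot>\<^sub>m 1\<^sub>m m"
    and "C \<equiv> \<lambda>i. mat_prod m B (filter (\<lambda>j. j \<noteq> i) [1..<Suc q])"
    and "is_decomposition \<equiv> \<lambda>W.
           W \<in> {1..q} \<rightarrow>\<^sub>E carrier_mat m m \<and>
           (\<forall>i\<in>{1..q}. mat_degree_less (W i) (d i)) \<and>
           P = mat_prod m B [1..<Suc q] + mat_sum m (\<lambda>i. W i * C i) {1..q}"
  shows "(\<exists>!W. is_decomposition W) \<and>
    \<comment> \<open>the inverses in the formulas exist\<close>
    (\<forall>i\<in>{1..<q}. \<exists>r. is_inverse_mod (b i) (\<Prod>j\<in>{1..<q} - {i}. b j) r) \<and>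
    (\<forall>i\<in>{1..<q}. \<exists>R. is_mat_inverse_mod (b i) (B q) R) \<and>
    (\<exists>r. is_inverse_mod (b q) (\<Prod>j\<in>{1..<q}. b j) r) \<and>
    (\<forall>j\<in>{1..<q}. \<exists>r. is_inverse_mod (b q) (b j) r) \<and>
    (\<forall>W. is_decomposition W \<longrightarrow>
      (\<forall>i\<in>{1..<q}.
         W i = mat_mod ((inverse_mod (b i) (\<Prod>j\<in>{1..<q} - {i}. b j) \<cdot>\<^sub>m P)
                        * mat_inverse_mod (b i) (B q)) (b i)) \<and>
      W q = mat_mod (inverse_mod (b q) (\<Prod>j\<in>{1..<q}. b j) \<cdot>\<^sub>m P
                     - [:s:] \<cdot>\<^sub>m 1\<^sub>m m
                     - [:s:] \<cdot>\<^sub>m mat_sum m (\<lambda>j. inverse_mod (b q) (b j) \<cdot>\<^sub>m W j) {1..<q}) (b q))"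
proof -
  define J where "J = {1..<q}"
  define \<beta> where "\<beta> = (\<Prod>j\<in>J. b j)"
  define \<beta>' where "\<beta>' i = (\<Prod>j\<in>J - {i}. b j)" for i
  define M where "M = b q \<cdot>\<^sub>m const_mat (Pc n) + [:s:] \<cdot>\<^sub>m 1\<^sub>m m"
  define S where "S W = mat_sum m (\<lambda>i. \<beta>' i \<cdot>\<^sub>m (W i * M)) J" for W
  have J: "finite J" "\<And>i. i \<in> J \<Longrightarrow> i \<in> {1..q} \<and> i \<noteq> q" "q \<in> {1..q}"
    using q by (auto simp: J_def)
  have J_q: "{1..q} = insert q J" "q \<notin> J" using q by (auto simp: J_def)
  have A: "Pc n \<in> carrier_mat m m" using Pc_carrier by simp
  have P: "P \<in> carrier_mat m m" by (simp add: P_eq)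
  have M: "M \<in> carrier_mat m m" using A by (simp add: M_def const_mat_def)
  have S: "S W \<in> carrier_mat m m" for W by (simp add: S_def)
  have Bq: "B q = M" by (simp add: B_def M_def)
  have BJ: "B j = b j \<cdot>\<^sub>m 1\<^sub>m m" if "j \<in> J" for j using that by (simp add: B_def J_def)
  have b0: "b i \<noteq> 0" and db: "degree (b i) > 0" if "i \<in> {1..q}" for i
    using b_monic[OF that] b_degree[OF that] d_pos[OF that] by auto

  have up: "[1..<Suc q] = [1..<q] @ [q]" using q by simp
  have Bprod: "mat_prod m B [1..<Suc q] = \<beta> \<cdot>\<^sub>m M"
    unfolding up \<beta>_def Bq[symmetric]
    by (subst mat_prod_scalars(2)[where f = b]) (use M Bq BJ in \<open>auto simp: J_def\<close>)
  have CJ: "C i = \<beta>' i \<cdot>\<^sub>m M" if "i \<in> J" for i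
  proof -
    have list: "filter (\<lambda>j. j \<noteq> i) [1..<Suc q] = filter (\<lambda>j. j \<noteq> i) [1..<q] @ [q]"
      using that unfolding up by (auto simp: J_def)
    have "set (filter (\<lambda>j. j \<noteq> i) [1..<q]) = J - {i}" by (auto simp: J_def)
    then show ?thesis
      unfolding C_def list \<beta>'_def Bq[symmetric]
      by (subst mat_prod_scalars(2)[where f = b]) (use M Bq BJ in auto)
  qed
  have Cq: "C q = \<beta> \<cdot>\<^sub>m 1\<^sub>m m"
  proof -
    have list: "filter (\<lambda>j. j \<noteq> q) [1..<Suc q] = [1..<q]"
      unfolding up by (simp add: filter_id_conv)
    show ?thesis
      unfolding C_def list \<beta>_def
      by (subst mat_prod_scalars(1)[where f = b]) (use BJ in \<open>auto simp: J_def\<close>)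
  qed
  have sum: "mat_sum m (\<lambda>i. W i * C i) {1..q} = S W + \<beta> \<cdot>\<^sub>m W q"
    if W: "\<And>i. i \<in> {1..q} \<Longrightarrow> W i \<in> carrier_mat m m" for W
  proof -
    have "W i * C i = \<beta>' i \<cdot>\<^sub>m (W i * M)" if "i \<in> J" for i
      using W[of i] J(2)[OF that] M by (simp add: CJ[OF that] mult_smult_distrib[of _ m m _ m])
    moreover have "W q * C q = \<beta> \<cdot>\<^sub>m W q"
      using W[OF J(3)] by (simp add: Cq mult_smult_distrib[of _ m m _ m])
    ultimately show ?thesis
      unfolding J_q(1) S_def
      by (intro eq_matI) (use J_q(2) J(1) W[OF J(3)] in \<open>auto simp: add.commute\<close>)
  qed
  have decomposition_iff: "is_decomposition W \<longleftrightarrow> W \<in> {1..q} \<rightarrow>\<^sub>E carrier_mat m m \<and>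
      (\<forall>i\<in>{1..q}. mat_mod (W i) (b i) = W i) \<and> P = \<beta> \<cdot>\<^sub>m M + (S W + \<beta> \<cdot>\<^sub>m W q)" for W
  proof (cases "W \<in> {1..q} \<rightarrow>\<^sub>E carrier_mat m m")
    case True
    then have W: "W i \<in> carrier_mat m m" if "i \<in> {1..q}" for i using that by (rule PiE_mem)
    have "mat_degree_less (W i) (d i) \<longleftrightarrow> mat_mod (W i) (b i) = W i" if "i \<in> {1..q}" for i
      using mat_degree_less_iff_mod[OF W[OF that] db[OF that]] b_degree[OF that] by simp
    moreover have "mat_sum m (\<lambda>i. W i * C i) {1..q} = S W + \<beta> \<cdot>\<^sub>m W q"
      using W by (rule sum)
    ultimately show ?thesis
      unfolding is_decomposition_def Bprod using True by simp
  qed (auto simp: is_decomposition_def)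

  have inv: "\<exists>r. is_inverse_mod (b i) (b j) r" if "i \<in> {1..q}" "j \<in> {1..q}" "i \<noteq> j" for i j
    using coprime_imp_inverse_mod[OF b_coprime[of j i]] that by auto
  have inv': "\<exists>r. is_inverse_mod (b i) (\<beta>' i) r" if "i \<in> J" for i
    unfolding \<beta>'_def by (rule prod_inverse_mod) (use that J inv in auto)
  have inv_q: "\<exists>r. is_inverse_mod (b q) (b j) r" if "j \<in> J" for j
    by (rule inv) (use that J in auto)
  have inv_\<beta>: "\<exists>r. is_inverse_mod (b q) \<beta> r"
    unfolding \<beta>_def by (rule prod_inverse_mod) (rule inv_q)
  have inv_M: "\<exists>R. is_mat_inverse_mod (b i) M R" if i: "i \<in> J" for i
  proof (rule det_coprime_imp_mat_inverse_mod[OF M], rule coprime_if_no_common_root)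
    show "b i \<noteq> 0" using b0 J i by blast
    fix x assume x: "poly (b i) x = 0"
    \<comment> \<open>Coprimality with \<open>b i\<close> gives the nonzero factor by which an eigenvalue is multiplied.\<close>
    have "poly (b q) x \<noteq> 0"
      using coprime_poly_0[OF b_coprime[of i q]] J i x by blast
    then show "poly (det M) x \<noteq> 0"
      unfolding M_def poly_det_affine[OF A]
      by (rule det_affine_nonzero[OF A]) (use s[of i] i x in \<open>auto simp: J_def\<close>)
  qed

  \<comment> \<open>The right-hand side of the claimed formula for \<open>W i\<close>.\<close>
  define F where "F i = mat_mod ((inverse_mod (b i) (\<beta>' i) \<cdot>\<^sub>m P) * mat_inverse_mod (b i) M) (b i)"
    for i
  have F: "F i \<in> carrier_mat m m" if "i \<in> J" for i
    unfolding F_def using P mat_inverse_mod_works(1)[OF M inv_M[OF that]] by auto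
  have W_eq_F: "W i = F i"
    if W: "is_decomposition W" and i: "i \<in> J" for W i
  proof -
    note D = W[unfolded decomposition_iff]
    have Wc: "W j \<in> carrier_mat m m" if "j \<in> {1..q}" for j using D that by auto
    define t where "t = inverse_mod (b i) (\<beta>' i)"
    define R where "R = mat_inverse_mod (b i) M"
    note R = mat_inverse_mod_works[OF M inv_M[OF i], folded R_def]
    have Wi: "W i \<in> carrier_mat m m" using Wc J i by blast
    \<comment> \<open>Both terms with the full factor \<open>\<beta>\<close> vanish modulo \<open>b i\<close>, so they are collected.\<close>
    have "P = S W + \<beta> \<cdot>\<^sub>m (M + W q)"
      using D M S[of W] Wc[OF J(3)] by (intro eq_matI) (auto simp: algebra_simps)
    also have "mat_mod \<dots> (b i) = mat_mod (\<beta>' i \<cdot>\<^sub>m (W i * M)) (b i)"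
      unfolding S_def \<beta>_def \<beta>'_def
    proof (rule partial_fractions_mod[OF J(1) i])
      show "W j * M \<in> carrier_mat m m" if "j \<in> J" for j
        using Wc[of j] J(2)[OF that] M by simp
      show "M + W q \<in> carrier_mat m m" using Wc[OF J(3)] M by simp
    qed
    finally have "mat_mod (t \<cdot>\<^sub>m P) (b i) = mat_mod (t \<cdot>\<^sub>m (\<beta>' i \<cdot>\<^sub>m (W i * M))) (b i)"
      by (rule mat_mod_smult_cong[OF cong_refl]) (use P Wi M in auto)
    also have "\<dots> = mat_mod (W i * M) (b i)"
      using inverse_mod_cancel[OF inv'[OF i]] Wi M
      by (subst mat_mod_eq_iff[of _ m m]) (auto simp: t_def)
    finally have "mat_mod ((t \<cdot>\<^sub>m P) * R) (b i) = mat_mod ((W i * M) * R) (b i)"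
      by (rule mat_mod_mult_cong[OF _ refl]) (use P Wi M R in auto)
    also have "(W i * M) * R = W i * (M * R)"
      using Wi M R by (simp add: assoc_mult_mat[of _ m m _ m _ m])
    also have "mat_mod \<dots> (b i) = mat_mod (W i * 1\<^sub>m m) (b i)"
      by (rule mat_mod_mult_cong[OF refl R(2)]) (use Wi M R in auto)
    also have "\<dots> = W i" using Wi D J(2)[OF i] by simp
    finally show ?thesis by (simp add: F_def t_def R_def)
  qed
  \<comment> \<open>Conversely, the formula solves the congruence; this does not presuppose a decomposition.\<close>
  have F_mod: "mat_mod P (b i) = mat_mod (\<beta>' i \<cdot>\<^sub>m (F i * M)) (b i)" if i: "i \<in> J" for i
  proof -
    define t where "t = inverse_mod (b i) (\<beta>' i)"
    define R where "R = mat_inverse_mod (b i) M"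
    note R = mat_inverse_mod_works[OF M inv_M[OF i], folded R_def]
    have "mat_mod (F i * M) (b i) = mat_mod (((t \<cdot>\<^sub>m P) * R) * M) (b i)"
      by (rule mat_mod_mult_cong[OF _ refl]) (use F[OF i] P M R in \<open>auto simp: F_def t_def R_def\<close>)
    also have "((t \<cdot>\<^sub>m P) * R) * M = (t \<cdot>\<^sub>m P) * (R * M)"
      using P M R by (simp add: assoc_mult_mat[of _ m m _ m _ m])
    also have "mat_mod \<dots> (b i) = mat_mod ((t \<cdot>\<^sub>m P) * 1\<^sub>m m) (b i)"
      by (rule mat_mod_mult_cong[OF refl R(3)]) (use P M R in auto)
    finally have "mat_mod (F i * M) (b i) = mat_mod (t \<cdot>\<^sub>m P) (b i)" using P by simp
    then have "mat_mod (\<beta>' i \<cdot>\<^sub>m (F i * M)) (b i) = mat_mod (\<beta>' i \<cdot>\<^sub>m (t \<cdot>\<^sub>m P)) (b i)"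
      by (rule mat_mod_smult_cong[OF cong_refl]) (use P F[OF i] M in auto)
    also have "\<dots> = mat_mod P (b i)"
      using inverse_mod_cancel[OF inv'[OF i]] P
      by (subst mat_mod_eq_iff[of _ m m]) (auto simp: t_def mult.left_commute)
    finally show ?thesis by simp
  qed

  have Wq_eq: "W q = mat_mod (inverse_mod (b q) \<beta> \<cdot>\<^sub>m P - [:s:] \<cdot>\<^sub>m 1\<^sub>m m
      - [:s:] \<cdot>\<^sub>m mat_sum m (\<lambda>j. inverse_mod (b q) (b j) \<cdot>\<^sub>m W j) J) (b q)"
    if W: "is_decomposition W" for W
  proof -
    note D = W[unfolded decomposition_iff]
    have Wc: "W j \<in> carrier_mat m m" if "j \<in> {1..q}" for j using D that by auto
    have "mat_mod M (b q) = mat_mod ([:s:] \<cdot>\<^sub>m 1\<^sub>m m) (b q)"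
      using A unfolding M_def
      by (subst mat_mod_eq_iff[of _ m m]) (auto simp: const_mat_def cong_iff_dvd_diff intro: dvd_smult)
    then have "mat_mod (W q) (b q) = mat_mod (inverse_mod (b q) \<beta> \<cdot>\<^sub>m P - [:s:] \<cdot>\<^sub>m 1\<^sub>m m
      - [:s:] \<cdot>\<^sub>m mat_sum m (\<lambda>j. inverse_mod (b q) (b j) \<cdot>\<^sub>m W j) J) (b q)"
      unfolding \<beta>_def
      by (intro last_numerator_mod[OF J(1) inv_q M])
         (use Wc J D in \<open>auto simp: S_def \<beta>_def \<beta>'_def\<close>)
    then show ?thesis using D J(3) by simp
  qed

  have deg_\<beta>: "degree \<beta> + d q = n" and monic_\<beta>: "lead_coeff \<beta> = 1"
  proof -
    have "degree \<beta> = (\<Sum>j\<in>J. d j)"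
      unfolding \<beta>_def using J b0 b_degree by (subst degree_prod_eq_sum_degree) (auto intro!: sum.cong)
    then show "degree \<beta> + d q = n" using d_sum J(1) J_q by simp
    show "lead_coeff \<beta> = 1"
      unfolding \<beta>_def lead_coeff_prod using J b_monic by (auto intro!: prod.neutral)
  qed
  have \<beta>0: "\<beta> \<noteq> 0" using monic_\<beta> by auto
  have deg_\<beta>': "degree (\<beta>' i) + d i = degree \<beta>" if "i \<in> J" for i
  proof -
    have "\<beta> = b i * \<beta>' i" unfolding \<beta>_def \<beta>'_def using J(1) that by (rule prod.remove)
    then show ?thesis using \<beta>0 b_degree J(2)[OF that] by (auto simp: degree_mult_eq)
  qed
  have deg_M: "mat_degree_less M (Suc (d q))"
    unfolding mat_degree_less_iff[OF M] using A b_degree[OF J(3)]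
    by (auto simp: M_def const_mat_def coeff_eq_0 coeff_pCons split: nat.split)
  \<comment> \<open>The coefficients at \<open>n\<close> cancel, and \<open>s * \<beta>\<close> has degree \<open>n - d q < n\<close>.\<close>
  have deg_P: "mat_degree_less (P - \<beta> \<cdot>\<^sub>m M) n"
  proof -
    have c: "P - \<beta> \<cdot>\<^sub>m M \<in> carrier_mat m m" using P M by auto
    have "coeff ((P - \<beta> \<cdot>\<^sub>m M) $$ (r, c)) k = 0" if rc: "r < m" "c < m" and k: "k \<ge> n" for r c k
    proof -
      have Pi: "(monom 1 i \<cdot>\<^sub>m const_mat (Pc i)) $$ (r, c) = monom (Pc i $$ (r, c)) i"
        if "i \<in> {0..n}" for i
        using Pc_carrier[of i] that rc
        by (simp add: const_mat_def mult.commute[of "monom 1 i"] smult_monom)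
      have cP: "coeff (P $$ (r, c)) k = (if k = n then Pc n $$ (r, c) else 0)"
        unfolding P_eq using rc k by (simp add: Pi coeff_sum) 
      have "(\<beta> \<cdot>\<^sub>m M) $$ (r, c)
          = Polynomial.smult (Pc n $$ (r, c)) (\<beta> * b q) + Polynomial.smult (s * 1\<^sub>m m $$ (r, c)) \<beta>"
        unfolding M_def using A rc by (auto simp: const_mat_def distrib_left)
      moreover have "coeff \<beta> k = 0"
        using deg_\<beta> d_pos[OF J(3)] k by (intro coeff_eq_0) linarith
      moreover have "coeff (\<beta> * b q) k = (if k = n then 1 else 0)"
      proof -
        have d: "degree (\<beta> * b q) = n"
          using deg_\<beta> \<beta>0 b0[OF J(3)] b_degree[OF J(3)] by (simp add: degree_mult_eq)
        moreover have "lead_coeff (\<beta> * b q) = 1"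
          using monic_\<beta> b_monic[OF J(3)] by (simp only: lead_coeff_mult mult_1)
        ultimately show ?thesis using k by (auto intro: coeff_eq_0)
      qed
      ultimately show ?thesis
        using cP P M rc by simp
    qed
    then show ?thesis unfolding mat_degree_less_iff[OF c] by blast
  qed

  have ex: "\<exists>W. is_decomposition W"
  proof -
    have FM: "F i * M \<in> carrier_mat m m" if "i \<in> J" for i using F[OF that] M by simp
    have "mat_mod (P - \<beta> \<cdot>\<^sub>m M) (b i) = mat_mod P (b i)" if "i \<in> J" for i
    proof -
      have "b i dvd \<beta>" unfolding \<beta>_def using J(1) that by (rule dvd_prodI)
      then show ?thesis
        using P M by (subst mat_mod_eq_iff[of _ m m]) (auto simp: cong_iff_dvd_diff)
    qed
    then have "\<exists>Z. Z \<in> carrier_mat m m \<and> P - \<beta> \<cdot>\<^sub>m M = S F + \<beta> \<cdot>\<^sub>m Z"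
      unfolding S_def \<beta>_def \<beta>'_def
      by (intro partial_fractions_exist[OF J(1)])
         (use b_coprime J(2) FM F_mod P M in \<open>auto simp: \<beta>_def \<beta>'_def\<close>)
    then obtain Z where Z: "Z \<in> carrier_mat m m" and eq: "P - \<beta> \<cdot>\<^sub>m M = S F + \<beta> \<cdot>\<^sub>m Z" by blast
    have "mat_degree_less (S F) n"
      unfolding S_def
    proof (rule mat_degree_less_sum)
      fix i assume i: "i \<in> J"
      have "mat_degree_less (F i) (d i)"
        using mat_degree_less_iff_mod[OF F[OF i] db] b_degree J(2)[OF i] by (simp add: F_def)
      then have "mat_degree_less (\<beta>' i \<cdot>\<^sub>m (F i * M)) (d i + d q + degree (\<beta>' i))"
        using mat_degree_less_mult[OF _ deg_M F[OF i] M] FM[OF i] mat_degree_less_smult by blast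
      also have "d i + d q + degree (\<beta>' i) = n" using deg_\<beta>'[OF i] deg_\<beta> by simp
      finally show "mat_degree_less (\<beta>' i \<cdot>\<^sub>m (F i * M)) n" .
      show "\<beta>' i \<cdot>\<^sub>m (F i * M) \<in> carrier_mat m m" using FM[OF i] by simp
    qed
    then have "mat_degree_less ((P - \<beta> \<cdot>\<^sub>m M) - S F) n"
      by (rule mat_degree_less_minus[OF deg_P _ minus_carrier_mat S]) (use M in simp)
    also have "(P - \<beta> \<cdot>\<^sub>m M) - S F = \<beta> \<cdot>\<^sub>m Z"
      unfolding eq using S[of F] Z by (intro eq_matI) auto
    finally have "mat_degree_less Z (d q)"
      using mat_degree_less_smult_cancel[OF _ \<beta>0 Z] deg_\<beta> by (simp add: add.commute)
    then have Z_mod: "mat_mod Z (b q) = Z"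
      using mat_degree_less_iff_mod[OF Z db[OF J(3)]] b_degree[OF J(3)] by simp
    define W where "W = restrict (F(q := Z)) {1..q}"
    have WJ: "W i = F i" if "i \<in> J" for i using J(2)[OF that] by (simp add: W_def)
    have Wq: "W q = Z" using J(3) by (simp add: W_def)
    have "S W = S F" unfolding S_def by (rule mat_sum_cong) (simp add: WJ)
    moreover have "P = \<beta> \<cdot>\<^sub>m M + (P - \<beta> \<cdot>\<^sub>m M)"
      using P M by (intro eq_matI) auto
    ultimately have "P = \<beta> \<cdot>\<^sub>m M + (S W + \<beta> \<cdot>\<^sub>m W q)" using eq Wq by simp
    moreover have "W i \<in> carrier_mat m m \<and> mat_mod (W i) (b i) = W i" if "i \<in> {1..q}" for i
      using that Z Z_mod F WJ Wq unfolding J_q(1) by (auto simp: F_def)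
    ultimately have "is_decomposition W"
      unfolding decomposition_iff by (auto simp: W_def)
    then show ?thesis by blast
  qed
  have unique: "W = W'" if W: "is_decomposition W" and W': "is_decomposition W'" for W W'
  proof (rule PiE_ext)
    show "W \<in> {1..q} \<rightarrow>\<^sub>E carrier_mat m m" "W' \<in> {1..q} \<rightarrow>\<^sub>E carrier_mat m m"
      using W W' by (auto simp: decomposition_iff)
    have J_eq: "W i = W' i" if "i \<in> J" for i
      using W_eq_F[OF W that] W_eq_F[OF W' that] by simp
    then have "W q = W' q"
      unfolding Wq_eq[OF W] Wq_eq[OF W'] by (simp cong: mat_sum_cong)
    with J_eq show "W i = W' i" if "i \<in> {1..q}" for i using that unfolding J_q(1) by auto
  qed
  have "\<exists>!W. is_decomposition W" using ex unique by blast
  then show ?thesis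
    using inv' inv_M inv_\<beta> inv_q W_eq_F Wq_eq
    by (simp add: Bq F_def \<beta>_def \<beta>'_def J_def)
qed

end
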